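(* Let $f:M\to M$ be a smooth ($\mathcal{C}^2$) map on a Riemannian manifold $M$, let $\Lambda\subset M$ be a repellor for $f$, and let $U$ be a neighbourhood of $\Lambda$ with $\Lambda=\bigcap_{n\in\mathbb Z}f^n(U)$ and $\bar U\subset f(U)$. Then $f^{-1}(\Lambda)\cap U=\Lambda$. If moreover $\Lambda$ is connected, then the number of $f$-preimages that a point of $\Lambda$ has in $\Lambda$ is constant, i.e. $x\mapsto \#\,(f^{-1}(x)\cap\Lambda)$ is constant on $\Lambda$.
   Context: Let $C_f$ be the critical set of $f$. A compact set $\Lambda\subset M$ is a basic set for $f$ if $f(\Lambda)=\Lambda$, $f|_\Lambda$ is topologically transitive, and there is a neighbourhood $U$ of $\Lambda$ with $\Lambda=\bigcap_{n\in\mathbb Z}f^n(U)$ (for $n<0$, $f^n(U)$ is the preimage $(f^{|n|})^{-1}(U)$). $\Lambda$ is a repellor for $f$ if it is a basic set for $f$, $C_f\cap\Lambda=\emptyset$, and there is a neighbourhood $U$ of $\Lambda$ with $\bar U\subset f(U)$. An $f$-preimage of $x$ is any point $y\in f^{-1}(x)$. *)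

theory Defs
  imports "HOL-Analysis.Analysis"
begin

section \<open>Maps of class \<open>C\<^sup>k\<close> between open subsets of normed spaces\<close>

text \<open>
  \<open>Ck_on k h S\<close> is meant for open \<open>S\<close>: it uses the derivative at a point of \<open>S\<close> in the whole
  space. As the domain is finite-dimensional in all uses, it is enough to ask for
  \<open>C\<^sup>k\<close> regularity of the derivative in each direction \<open>v\<close> separately.
\<close>

primrec Ck_on ::
  "nat \<Rightarrow> ('a::real_normed_vector \<Rightarrow> 'b::real_normed_vector) \<Rightarrow> 'a set \<Rightarrow> bool" where
  "Ck_on 0 h S \<longleftrightarrow> continuous_on S h"
| "Ck_on (Suc k) h S \<longleftrightarrow>
     (\<forall>x\<in>S. h differentiable (at x)) \<and>
     (\<forall>v. Ck_on k (\<lambda>x. frechet_derivative h (at x) v) S)"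

definition smooth_on ::
  "('a::real_normed_vector \<Rightarrow> 'b::real_normed_vector) \<Rightarrow> 'a set \<Rightarrow> bool" where
  "smooth_on h S \<longleftrightarrow> (\<forall>k. Ck_on k h S)"


section \<open>Smooth and Riemannian manifolds\<close>

text \<open>
  The underlying space of a manifold \<open>M\<close> is a type \<open>'a\<close> with its topology; its dimension is
  \<open>DIM('e)\<close>. Charts are pairs of a domain and a coordinate map, the values of the latter outside
  the domain being irrelevant.
\<close>

type_synonym ('a, 'e) chart = "'a set \<times> ('a \<Rightarrow> 'e)"

abbreviation chart_dom :: "('a, 'e) chart \<Rightarrow> 'a set" where
  "chart_dom c \<equiv> fst c"

abbreviation chart_map :: "('a, 'e) chart \<Rightarrow> 'a \<Rightarrow> 'e" where
  "chart_map c \<equiv> snd c"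

definition chart_inv :: "('a, 'e) chart \<Rightarrow> 'e \<Rightarrow> 'a" where
  "chart_inv c = inv_into (chart_dom c) (chart_map c)"

definition is_chart :: "('a::topological_space, 'e::euclidean_space) chart \<Rightarrow> bool" where
  "is_chart c \<longleftrightarrow>
     open (chart_dom c) \<and> open (chart_map c ` chart_dom c) \<and>
     homeomorphism (chart_dom c) (chart_map c ` chart_dom c) (chart_map c) (chart_inv c)"

definition transition :: "('a, 'e) chart \<Rightarrow> ('a, 'e) chart \<Rightarrow> 'e \<Rightarrow> 'e" where
  "transition c d = chart_map d \<circ> chart_inv c"

text \<open>
  Hausdorff and second countable are imposed through the type classes. The atlas need not be
  maximal; every notion below only depends on the smooth structure that it generates.
\<close>

definition smooth_atlas ::
  "('a::{t2_space, second_countable_topology}, 'e::euclidean_space) chart set \<Rightarrow> bool" where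
  "smooth_atlas A \<longleftrightarrow>
     (\<forall>c\<in>A. is_chart c) \<and>
     (\<Union>c\<in>A. chart_dom c) = UNIV \<and>
     (\<forall>c\<in>A. \<forall>d\<in>A.
        smooth_on (transition c d) (chart_map c ` (chart_dom c \<inter> chart_dom d)))"

definition inner_product_form :: "('e::real_vector \<Rightarrow> 'e \<Rightarrow> real) \<Rightarrow> bool" where
  "inner_product_form b \<longleftrightarrow>
     bilinear b \<and> (\<forall>v w. b v w = b w v) \<and> (\<forall>v. v \<noteq> 0 \<longrightarrow> b v v > 0)"

text \<open>
  A Riemannian metric is given by its coordinate representations: \<open>g c z\<close> is the inner product on
  the tangent space at \<open>chart_inv c z\<close>, the tangent space being identified with \<open>'e\<close> by the chart
  \<open>c\<close>. The last clause is the transformation law of a covariant 2-tensor.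
\<close>

definition riemannian_metric ::
  "('a, 'e::euclidean_space) chart set \<Rightarrow>
   (('a, 'e) chart \<Rightarrow> 'e \<Rightarrow> 'e \<Rightarrow> 'e \<Rightarrow> real) \<Rightarrow> bool" where
  "riemannian_metric A g \<longleftrightarrow>
     (\<forall>c\<in>A. \<forall>z\<in>chart_map c ` chart_dom c. inner_product_form (g c z)) \<and>
     (\<forall>c\<in>A. \<forall>v w. smooth_on (\<lambda>z. g c z v w) (chart_map c ` chart_dom c)) \<and>
     (\<forall>c\<in>A. \<forall>d\<in>A. \<forall>z\<in>chart_map c ` (chart_dom c \<inter> chart_dom d). \<forall>v w.
        g c z v w =
          g d (transition c d z)
            (frechet_derivative (transition c d) (at z) v)
            (frechet_derivative (transition c d) (at z) w))"

definition riemannian_manifold ::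
  "('a::{t2_space, second_countable_topology}, 'e::euclidean_space) chart set \<Rightarrow>
   (('a, 'e) chart \<Rightarrow> 'e \<Rightarrow> 'e \<Rightarrow> 'e \<Rightarrow> real) \<Rightarrow> bool" where
  "riemannian_manifold A g \<longleftrightarrow> smooth_atlas A \<and> riemannian_metric A g"


section \<open>Differentiable self-maps and their critical sets\<close>

definition in_charts ::
  "('a, 'e) chart \<Rightarrow> ('a, 'e) chart \<Rightarrow> ('a \<Rightarrow> 'a) \<Rightarrow> 'e \<Rightarrow> 'e" where
  "in_charts c d f = chart_map d \<circ> f \<circ> chart_inv c"

definition Ck_map ::
  "nat \<Rightarrow> ('a::topological_space, 'e::euclidean_space) chart set \<Rightarrow> ('a \<Rightarrow> 'a) \<Rightarrow> bool" where
  "Ck_map k A f \<longleftrightarrow>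
     continuous_on UNIV f \<and>
     (\<forall>c\<in>A. \<forall>d\<in>A.
        Ck_on k (in_charts c d f) (chart_map c ` (chart_dom c \<inter> f -` chart_dom d)))"

text \<open>
  The points at which the tangent map of \<open>f\<close> is not onto. By the chain rule the condition does not
  depend on the choice of the charts \<open>c\<close> and \<open>d\<close>; source and target have equal dimension, so it
  also says that the tangent map is not an isomorphism.
\<close>

definition critical_set ::
  "('a, 'e::euclidean_space) chart set \<Rightarrow> ('a \<Rightarrow> 'a) \<Rightarrow> 'a set" where
  "critical_set A f =
     {x. \<exists>c\<in>A. \<exists>d\<in>A. x \<in> chart_dom c \<and> f x \<in> chart_dom d \<and>
        \<not> surj (frechet_derivative (in_charts c d f) (at (chart_map c x)))}"


section \<open>Basic sets and repellors\<close>

definition neighbourhood_of :: "'a::topological_space set \<Rightarrow> 'a set \<Rightarrow> bool" where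
  "neighbourhood_of S U \<longleftrightarrow> S \<subseteq> interior U"

text \<open>\<open>f\<^sup>n(U)\<close> for an integer \<open>n\<close>: forward image for \<open>n \<ge> 0\<close>, preimage under the \<open>|n|\<close>-th iterate
  for \<open>n < 0\<close>.\<close>

definition iterate_set :: "('a \<Rightarrow> 'a) \<Rightarrow> int \<Rightarrow> 'a set \<Rightarrow> 'a set" where
  "iterate_set f n U =
     (if n \<ge> 0 then (f ^^ nat n) ` U else (f ^^ nat \<bar>n\<bar>) -` U)"

definition topologically_transitive_on ::
  "'a::topological_space set \<Rightarrow> ('a \<Rightarrow> 'a) \<Rightarrow> bool" where
  "topologically_transitive_on \<Lambda> f \<longleftrightarrow>
     (\<forall>V W. openin (top_of_set \<Lambda>) V \<and> openin (top_of_set \<Lambda>) W \<and> V \<noteq> {} \<and> W \<noteq> {} \<longrightarrow>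
        (\<exists>n. (f ^^ n) ` V \<inter> W \<noteq> {}))"

definition basic_set :: "('a::topological_space \<Rightarrow> 'a) \<Rightarrow> 'a set \<Rightarrow> bool" where
  "basic_set f \<Lambda> \<longleftrightarrow>
     compact \<Lambda> \<and> f ` \<Lambda> = \<Lambda> \<and> topologically_transitive_on \<Lambda> f \<and>
     (\<exists>U. neighbourhood_of \<Lambda> U \<and> \<Lambda> = (\<Inter>n. iterate_set f n U))"

definition repellor ::
  "('a::topological_space, 'e::euclidean_space) chart set \<Rightarrow> ('a \<Rightarrow> 'a) \<Rightarrow> 'a set \<Rightarrow> bool" where
  "repellor A f \<Lambda> \<longleftrightarrow>
     basic_set f \<Lambda> \<and> critical_set A f \<inter> \<Lambda> = {} \<and>
     (\<exists>U. neighbourhood_of \<Lambda> U \<and> closure U \<subseteq> f ` U)"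

end

theory Submission
  imports Defs
begin

text \<open>
  The first claim is formal: \<open>U \<subseteq> closure U \<subseteq> f ` U\<close> iterates to \<open>U \<subseteq> (f ^^ n) ` U\<close>, so a point of \<open>U\<close>
  satisfies the conditions defining \<open>\<Lambda>\<close> for all \<open>n \<ge> 0\<close> at no cost, while the conditions for
  \<open>n < 0\<close> only involve its forward orbit, which stays in \<open>\<Lambda>\<close> as soon as \<open>f x \<in> \<Lambda>\<close>.

  For the second claim, the inverse function theorem makes \<open>f\<close> locally injective near every point of
  \<open>\<Lambda>\<close>, since \<open>\<Lambda>\<close> avoids the critical set, and invariance of domain makes it open there
  (\<open>noncritical_locally_injective_open\<close>). The first claim (\<open>preimage_of_maximal_invariant_set\<close>)
  shows that the restriction \<open>f : \<Lambda> \<rightarrow> \<Lambda>\<close> is open as well: a preimage of a point of \<open>\<Lambda>\<close> that is close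
  to \<open>\<Lambda>\<close> lies in \<open>U\<close>, hence in \<open>\<Lambda>\<close> (\<open>open_map_restrict\<close>). So \<open>f\<close> restricts to a local homeomorphism
  of a compact Hausdorff space. Such a map has finite fibres whose cardinality is locally constant
  (\<open>local_homeomorphism_compact_fibres\<close>), hence constant when \<open>\<Lambda>\<close> is connected.
\<close>

section \<open>Local homeomorphisms of compact spaces\<close>

lemma finite_pairwise_disjoint_nhds:
  fixes F :: "'a::t2_space set"
  assumes "finite F"
  obtains D where "\<And>y. y \<in> F \<Longrightarrow> open (D y) \<and> y \<in> D y"
    and "\<And>y z. y \<in> F \<Longrightarrow> z \<in> F \<Longrightarrow> y \<noteq> z \<Longrightarrow> D y \<inter> D z = {}"
proof -
  have "\<forall>y z::'a. \<exists>P Q. y \<noteq> z \<longrightarrow> open P \<and> open Q \<and> y \<in> P \<and> z \<in> Q \<and> P \<inter> Q = {}"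
    by (meson hausdorff)
  then obtain P Q where PQ: "\<And>y z::'a. y \<noteq> z \<Longrightarrow>
      open (P y z) \<and> open (Q y z) \<and> y \<in> P y z \<and> z \<in> Q y z \<and> P y z \<inter> Q y z = {}"
    by metis
  define D where "D = (\<lambda>y. \<Inter>z\<in>F - {y}. P y z \<inter> Q z y)"
  show thesis
  proof
    fix y assume "y \<in> F"
    have "open (D y)"
      unfolding D_def using assms PQ by (intro open_INT) auto
    moreover have "y \<in> P y z \<inter> Q z y" if "y \<noteq> z" for z
      using PQ[of y z] PQ[of z y] that by auto
    then have "y \<in> D y"
      unfolding D_def by auto
    ultimately show "open (D y) \<and> y \<in> D y" ..
  next
    fix y z assume yz: "y \<in> F" "z \<in> F" "y \<noteq> z"
    then have "D y \<subseteq> P y z" "D z \<subseteq> Q y z"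
      by (auto simp: D_def)
    then show "D y \<inter> D z = {}"
      using PQ[OF yz(3)] by blast
  qed
qed

text \<open>
  The fibre over \<open>x\<close> is compact and discrete, hence finite. Choose disjoint neighbourhoods of its
  points on which \<open>f\<close> is injective. A point close to \<open>x\<close> lies in the image of each of them, and it has
  no preimage elsewhere because the image of the remaining compact set is closed and misses \<open>x\<close>; so
  it has exactly one preimage for each point of the fibre.
\<close>

lemma local_homeomorphism_compact_fibres:
  fixes f :: "'a::t2_space \<Rightarrow> 'b::t2_space"
  assumes "compact X" and cont: "continuous_on X f" and "x \<in> Y"
    and inj: "\<And>y. y \<in> X \<Longrightarrow> \<exists>N. openin (top_of_set X) N \<and> y \<in> N \<and> inj_on f N"
    and openmap: "\<And>W. openin (top_of_set X) W \<Longrightarrow> openin (top_of_set Y) (f ` W)"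
  shows "finite (f -` {x} \<inter> X)"
    and "\<exists>T. openin (top_of_set Y) T \<and> x \<in> T \<and>
           (\<forall>x'\<in>T. card (f -` {x'} \<inter> X) = card (f -` {x} \<inter> X))"
proof -
  define F where "F = f -` {x} \<inter> X"
  have "\<forall>y. \<exists>N. y \<in> X \<longrightarrow> open N \<and> y \<in> N \<and> inj_on f (N \<inter> X)"
    using inj by (metis Int_iff inf_commute openin_open)
  then obtain N where N: "\<And>y. y \<in> X \<Longrightarrow> open (N y) \<and> y \<in> N y \<and> inj_on f (N y \<inter> X)"
    by metis
  have "closedin (top_of_set X) F"
    unfolding F_def using continuous_closedin_preimage[OF cont, of "{x}"] by (simp add: Int_commute)
  then have "compact F"
    using \<open>compact X\<close> closedin_compact by blast
  obtain F' where F': "F' \<subseteq> F" "finite F'" "F \<subseteq> (\<Union>y\<in>F'. N y)"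
  proof (rule compactE_image[OF \<open>compact F\<close>, of F N])
    show "open (N y)" if "y \<in> F" for y
      using N that by (simp add: F_def)
    show "F \<subseteq> (\<Union>y\<in>F. N y)"
      using N by (force simp: F_def)
  qed blast
  \<comment> \<open>Each \<open>N z\<close> contains a single point of the fibre, so the subcover uses every point.\<close>
  have "F \<subseteq> F'"
  proof
    fix y assume y: "y \<in> F"
    then obtain z where z: "z \<in> F'" "y \<in> N z" using F' by blast
    then have "z \<in> X" "f y = f z" "y \<in> X" using y F' by (auto simp: F_def)
    then have "y = z" using N[of z] z by (auto simp: inj_on_def)
    then show "y \<in> F'" using z by simp
  qed
  then have fin: "finite F" using F' finite_subset by blast
  then show "finite (f -` {x} \<inter> X)" by (simp add: F_def)
  obtain D where D: "\<And>y. y \<in> F \<Longrightarrow> open (D y) \<and> y \<in> D y"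
    and disj: "\<And>y z. y \<in> F \<Longrightarrow> z \<in> F \<Longrightarrow> y \<noteq> z \<Longrightarrow> D y \<inter> D z = {}"
    using finite_pairwise_disjoint_nhds[OF fin] by blast
  define V where "V = (\<lambda>y. X \<inter> (N y \<inter> D y))"
  have V: "openin (top_of_set X) (V y)" "y \<in> V y" "inj_on f (V y)" if "y \<in> F" for y
    using that N[of y] D[of y] unfolding V_def
    by (auto simp: F_def intro: openin_open_Int inj_on_subset)
  define C where "C = f ` (X - (\<Union>y\<in>F. V y))"
  \<comment> \<open>Over an empty fibre the intersection is \<open>UNIV\<close>, so \<open>T\<close> is then \<open>Y - f ` X\<close>.\<close>
  define T where "T = (Y - C) \<inter> (\<Inter>y\<in>F. Y \<inter> f ` V y)"
  have "closed C"
  proof -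
    have "openin (top_of_set X) (\<Union>y\<in>F. V y)" using V by blast
    then have "closedin (top_of_set X) (X - (\<Union>y\<in>F. V y))"
      by (intro closedin_diff) auto
    then have cpt: "compact (X - (\<Union>y\<in>F. V y))"
      using \<open>compact X\<close> closedin_compact by blast
    have "compact C"
      unfolding C_def by (rule compact_continuous_image[OF continuous_on_subset[OF cont] cpt]) auto
    then show ?thesis by (rule compact_imp_closed)
  qed
  have "openin (top_of_set Y) (Y - C)"
    using \<open>closed C\<close> by (simp add: Diff_eq openin_open_Int open_Compl)
  then have "openin (top_of_set Y) T"
    unfolding T_def using fin
    by (cases "F = {}") (auto intro!: openin_Int openin_INT2 openmap V)
  moreover have "x \<in> T"
  proof -
    have "x \<notin> C"
      using V(2) by (auto simp: C_def F_def)
    moreover have "x \<in> f ` V y" if "y \<in> F" for y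
      using V(2)[OF that] that by (auto simp: F_def)
    ultimately show ?thesis
      using \<open>x \<in> Y\<close> by (simp add: T_def)
  qed
  moreover have "card (f -` {x'} \<inter> X) = card F" if "x' \<in> T" for x'
  proof -
    have "\<forall>y. \<exists>q. y \<in> F \<longrightarrow> q \<in> V y \<and> f q = x'"
      using that unfolding T_def by blast
    then obtain q where q: "\<And>y. y \<in> F \<Longrightarrow> q y \<in> V y \<and> f (q y) = x'" by metis
    have "inj_on q F"
      using q disj unfolding inj_on_def V_def by (metis Int_iff empty_iff)
    moreover have "q ` F = f -` {x'} \<inter> X"
    proof (intro equalityI subsetI)
      fix p assume "p \<in> q ` F"
      then show "p \<in> f -` {x'} \<inter> X" using q by (auto simp: V_def)
    next
      fix p assume p: "p \<in> f -` {x'} \<inter> X"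
      moreover have "x' \<notin> C"
        using that by (simp add: T_def)
      ultimately obtain y where y: "y \<in> F" "p \<in> V y"
        unfolding C_def by blast
      then have "p = q y"
        using V(3)[OF y(1)] q[OF y(1)] p by (auto dest: inj_onD)
      then show "p \<in> q ` F" using y by blast
    qed
    ultimately show ?thesis by (metis card_image)
  qed
  ultimately show "\<exists>T. openin (top_of_set Y) T \<and> x \<in> T \<and>
      (\<forall>x'\<in>T. card (f -` {x'} \<inter> X) = card (f -` {x} \<inter> X))"
    unfolding F_def by blast
qed


section \<open>Differentiable maps away from critical points\<close>

text \<open>
  In finite dimension, continuity of each directional derivative gives continuity of the derivative
  in operator norm, because the operator norm is at most the sum of the norms of the values on a
  basis.
\<close>

lemma C1_locally_injective:
  fixes h :: "'e::euclidean_space \<Rightarrow> 'e"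
  assumes "Ck_on 1 h S" "open S" "a \<in> S"
    and surj: "surj (frechet_derivative h (at a))"
  obtains r where "r > 0" "ball a r \<subseteq> S" "inj_on h (ball a r)"
proof -
  let ?D = "\<lambda>x. frechet_derivative h (at x)"
  have deriv: "(h has_derivative ?D x) (at x)" if "x \<in> S" for x
    using assms(1) that frechet_derivative_works by auto
  have cont: "continuous_on S (\<lambda>x. ?D x v)" for v
    using assms(1) by simp
  have lin: "linear (?D a)"
    using deriv[OF \<open>a \<in> S\<close>] has_derivative_linear by blast
  then have "inj (?D a)"
    using surj by (simp add: linear_surjective_imp_injective)
  then obtain L where L: "linear L" "L \<circ> ?D a = id"
    using linear_injective_left_inverse[OF lin] by blast
  have near: "\<exists>d>0. \<forall>x. dist a x < d \<longrightarrow> onorm (\<lambda>v. ?D x v - ?D a v) < e" if "e > 0" for e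
  proof -
    let ?s = "\<lambda>x. \<Sum>i\<in>Basis. norm (?D x i - ?D a i)"
    have "continuous_on S ?s"
      by (intro continuous_intros cont)
    then have "isCont ?s a"
      using \<open>open S\<close> \<open>a \<in> S\<close> continuous_on_eq_continuous_at by blast
    then have "(?s \<longlongrightarrow> 0) (at a)"
      by (simp add: isCont_def)
    then have "\<forall>\<^sub>F x in at a. ?s x < e"
      using \<open>e > 0\<close> by (rule order_tendstoD)
    moreover have "?s a < e" using \<open>e > 0\<close> by simp
    ultimately have "\<forall>\<^sub>F x in nhds a. ?s x < e"
      by (simp add: eventually_nhds_conv_at)
    moreover have "\<forall>\<^sub>F x in nhds a. x \<in> S"
      using \<open>open S\<close> \<open>a \<in> S\<close> by (rule eventually_nhds_in_open)
    ultimately have "\<forall>\<^sub>F x in nhds a. onorm (\<lambda>v. ?D x v - ?D a v) < e"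
    proof eventually_elim
      case (elim x)
      have "bounded_linear (\<lambda>v. ?D x v - ?D a v)"
        using deriv[OF elim(2)] deriv[OF \<open>a \<in> S\<close>]
        by (intro bounded_linear_sub has_derivative_bounded_linear)
      then show ?case
        by (rule le_less_trans[OF onorm_componentwise elim(1)])
    qed
    then show ?thesis
      by (simp add: eventually_nhds_metric dist_commute)
  qed
  show thesis
    using has_derivative_locally_injective[OF \<open>a \<in> S\<close> \<open>open S\<close> _ L(2) deriv near] that L(1)
    by (auto simp: linear_conv_bounded_linear)
qed

lemma chart_image_open:
  assumes "is_chart c" "open W" "W \<subseteq> chart_dom c"
  shows "open (chart_map c ` W)"
proof -
  have "openin (top_of_set (chart_map c ` chart_dom c)) (chart_map c ` W)"
    using assms homeomorphism_imp_open_map unfolding is_chart_def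
    by (metis openin_open_eq)
  then show ?thesis
    using assms(1) unfolding is_chart_def by (metis openin_open_eq)
qed

lemma chart_inv_image_open:
  assumes "is_chart c" "open W" "W \<subseteq> chart_map c ` chart_dom c"
  shows "open (chart_inv c ` W)"
proof -
  have "homeomorphism (chart_map c ` chart_dom c) (chart_dom c) (chart_inv c) (chart_map c)"
    using assms(1) homeomorphism_sym unfolding is_chart_def by blast
  moreover have "openin (top_of_set (chart_map c ` chart_dom c)) W"
    using assms is_chart_def openin_open_eq by metis
  ultimately have "openin (top_of_set (chart_dom c)) (chart_inv c ` W)"
    by (rule homeomorphism_imp_open_map)
  then show ?thesis
    using assms(1) unfolding is_chart_def by (metis openin_open_eq)
qed

lemma chart_inv_left: "is_chart c \<Longrightarrow> x \<in> chart_dom c \<Longrightarrow> chart_inv c (chart_map c x) = x"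
  unfolding is_chart_def homeomorphism_def by blast

text \<open>
  In charts the inverse function theorem gives local injectivity; as source and target have the
  same dimension, openness then follows from invariance of domain.
\<close>

lemma noncritical_locally_injective_open:
  fixes A :: "('a::{t2_space, second_countable_topology}, 'e::euclidean_space) chart set"
  assumes "smooth_atlas A" "Ck_map 2 A f" "y \<notin> critical_set A f"
  obtains V where "open V" "y \<in> V" "inj_on f V" "\<And>W. open W \<Longrightarrow> W \<subseteq> V \<Longrightarrow> open (f ` W)"
proof -
  obtain c where c: "c \<in> A" "y \<in> chart_dom c" "is_chart c"
    using assms(1) unfolding smooth_atlas_def by blast
  obtain d where d: "d \<in> A" "f y \<in> chart_dom d" "is_chart d"
    using assms(1) unfolding smooth_atlas_def by blast
  define h where "h = in_charts c d f"
  define G where "G = chart_dom c \<inter> f -` chart_dom d"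
  define S where "S = chart_map c ` G"
  define a where "a = chart_map c y"
  have contf: "continuous_on UNIV f" and "Ck_on 2 h S"
    using assms(2) c(1) d(1) by (auto simp: Ck_map_def h_def S_def G_def)
  have openc: "open (chart_dom c)" and openx: "open (chart_dom d)"
    using c(3) d(3) by (auto simp: is_chart_def)
  have "open G"
    unfolding G_def using openc open_vimage[OF openx contf] by blast
  then have "open S"
    unfolding S_def using c(3) by (intro chart_image_open) (auto simp: G_def)
  have "a \<in> S"
    using c d by (auto simp: S_def G_def a_def)
  have h: "Ck_on 1 h S"
    using \<open>Ck_on 2 h S\<close>
    by (auto simp: numeral_2_eq_2
        intro!: continuous_at_imp_continuous_on differentiable_imp_continuous_within)
  have "surj (frechet_derivative h (at a))"
    using assms(3) c d by (auto simp: critical_set_def h_def a_def)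
  then obtain r where r: "r > 0" "ball a r \<subseteq> S" "inj_on h (ball a r)"
    using C1_locally_injective[OF h \<open>open S\<close> \<open>a \<in> S\<close>] by blast
  have conth: "continuous_on (ball a r) h"
    using h r(2) by (auto intro!: continuous_at_imp_continuous_on differentiable_imp_continuous_within)
  define V where "V = G \<inter> chart_map c -` ball a r"
  have contc: "continuous_on G (chart_map c)"
    using c(3) unfolding is_chart_def homeomorphism_def G_def
    by (meson continuous_on_subset inf_le1)
  have fh: "chart_map d (f x) = h (chart_map c x)" if "x \<in> G" for x
    using that c(3) by (auto simp: h_def in_charts_def G_def chart_inv_left)
  show thesis
  proof
    show "open V"
      unfolding V_def using \<open>open G\<close> contc by (simp add: continuous_open_preimage)
    show "y \<in> V"
      using c d r(1) by (auto simp: V_def G_def a_def)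
    show "inj_on f V"
    proof (rule inj_onI)
      fix u v assume uv: "u \<in> V" "v \<in> V" "f u = f v"
      then have "h (chart_map c u) = h (chart_map c v)"
        using fh by (metis Int_iff V_def)
      then have "chart_map c u = chart_map c v"
        using r(3) uv by (auto simp: V_def dest: inj_onD)
      then show "u = v"
        using uv c(3) chart_inv_left by (metis Int_iff V_def G_def)
    qed
  next
    fix W assume W: "open W" "W \<subseteq> V"
    have "open (chart_map c ` W)"
      using W c(3) by (intro chart_image_open) (auto simp: V_def G_def)
    moreover have sub: "chart_map c ` W \<subseteq> ball a r"
      using W by (auto simp: V_def)
    ultimately have "open (h ` chart_map c ` W)"
      using conth r(3)
      by (intro invariance_of_domain) (auto intro: continuous_on_subset inj_on_subset)
    moreover have "h ` chart_map c ` W = chart_map d ` f ` W"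
      unfolding image_image using fh W by (intro image_cong) (auto simp: V_def)
    moreover have fW: "f ` W \<subseteq> chart_dom d"
      using W by (auto simp: V_def G_def)
    ultimately have "open (chart_inv d ` chart_map d ` f ` W)"
      using d(3) by (intro chart_inv_image_open) auto
    moreover have "chart_inv d ` chart_map d ` f ` W = f ` W"
      using fW d(3) by (force simp: image_image chart_inv_left)
    ultimately show "open (f ` W)" by simp
  qed
qed


section \<open>Repellors\<close>

lemma subset_funpow_image:
  assumes "U \<subseteq> f ` U"
  shows "U \<subseteq> (f ^^ n) ` U"
proof (induction n)
  case (Suc n)
  have "U \<subseteq> f ` (f ^^ n) ` U"
    using assms Suc by blast
  then show ?case by (simp add: image_comp)
qed simp

lemma preimage_of_maximal_invariant_set:
  assumes L: "\<Lambda> = (\<Inter>n. iterate_set f n U)" and "f ` \<Lambda> = \<Lambda>" and "U \<subseteq> f ` U"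
  shows "f -` \<Lambda> \<inter> U = \<Lambda>"
proof
  have sub: "\<Lambda> \<subseteq> U"
  proof -
    have "\<Lambda> \<subseteq> iterate_set f 0 U"
      using L by blast
    then show ?thesis by (simp add: iterate_set_def)
  qed
  then show "\<Lambda> \<subseteq> f -` \<Lambda> \<inter> U"
    using assms(2) by blast
  show "f -` \<Lambda> \<inter> U \<subseteq> \<Lambda>"
  proof
    fix x assume x: "x \<in> f -` \<Lambda> \<inter> U"
    have orbit: "(f ^^ k) (f x) \<in> \<Lambda>" for k
      using x assms(2) by (induction k) auto
    have "x \<in> iterate_set f n U" for n
    proof (cases "n \<ge> 0")
      case True
      then show ?thesis
        using x subset_funpow_image[OF assms(3), of "nat n"] by (auto simp: iterate_set_def)
    next
      case False
      then obtain k where k: "nat \<bar>n\<bar> = Suc k"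
        by (metis abs_of_neg gr0_conv_Suc neg_0_less_iff_less not_le zero_less_nat_eq)
      then have "(f ^^ nat \<bar>n\<bar>) x = (f ^^ k) (f x)"
        by (simp add: funpow_swap1)
      then show ?thesis
        using False orbit[of k] sub by (auto simp: iterate_set_def)
    qed
    then show "x \<in> \<Lambda>" using L by blast
  qed
qed

text \<open>
  This is where the first claim enters the second: an open map of \<open>M\<close> need not restrict to an open
  map of an invariant set \<open>\<Lambda>\<close>, but it does when, near \<open>\<Lambda>\<close>, preimages of points of \<open>\<Lambda>\<close> stay in \<open>\<Lambda>\<close>.
\<close>

lemma open_map_restrict:
  assumes "f ` \<Lambda> \<subseteq> \<Lambda>" and "\<Lambda> \<subseteq> interior U" and pre: "f -` \<Lambda> \<inter> U \<subseteq> \<Lambda>"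
    and loc: "\<And>y. y \<in> \<Lambda> \<Longrightarrow> \<exists>V. open V \<and> y \<in> V \<and> (\<forall>W. open W \<and> W \<subseteq> V \<longrightarrow> open (f ` W))"
    and "openin (top_of_set \<Lambda>) W"
  shows "openin (top_of_set \<Lambda>) (f ` W)"
proof (subst openin_subopen, intro ballI)
  obtain P where P: "open P" "W = \<Lambda> \<inter> P"
    using assms(5) openin_open by blast
  fix z assume "z \<in> f ` W"
  then obtain y where y: "y \<in> W" "z = f y" by blast
  then obtain V where V: "open V" "y \<in> V" "\<And>W. open W \<Longrightarrow> W \<subseteq> V \<Longrightarrow> open (f ` W)"
    using loc P by (metis Int_iff)
  let ?Q = "V \<inter> P \<inter> interior U"
  have "open (f ` ?Q)"
    using V P by (intro V(3)) auto
  then have "openin (top_of_set \<Lambda>) (\<Lambda> \<inter> f ` ?Q)" by blast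
  moreover have "z \<in> \<Lambda> \<inter> f ` ?Q"
    using y P V(2) assms(1,2) by blast
  moreover have "\<Lambda> \<inter> f ` ?Q \<subseteq> f ` W"
    using pre P(2) interior_subset[of U] by blast
  ultimately show "\<exists>T. openin (top_of_set \<Lambda>) T \<and> z \<in> T \<and> T \<subseteq> f ` W" by blast
qed

theorem proposition1:
  fixes A :: "('a::{t2_space, second_countable_topology}, 'e::euclidean_space) chart set"
    and g :: "('a, 'e) chart \<Rightarrow> 'e \<Rightarrow> 'e \<Rightarrow> 'e \<Rightarrow> real"
    and f :: "'a \<Rightarrow> 'a"
    and \<Lambda> U :: "'a set"
  assumes "riemannian_manifold A g"
    and "Ck_map 2 A f"
    and "repellor A f \<Lambda>"
    and "neighbourhood_of \<Lambda> U"
    and "\<Lambda> = (\<Inter>n. iterate_set f n U)"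
    and "closure U \<subseteq> f ` U"
  shows "f -` \<Lambda> \<inter> U = \<Lambda> \<and>
    (connected \<Lambda> \<longrightarrow>
      (\<exists>N. \<forall>x\<in>\<Lambda>. finite (f -` {x} \<inter> \<Lambda>) \<and> card (f -` {x} \<inter> \<Lambda>) = N))"
proof -
  have cpt: "compact \<Lambda>" and inv: "f ` \<Lambda> = \<Lambda>" and noncrit: "critical_set A f \<inter> \<Lambda> = {}"
    using assms(3) by (auto simp: repellor_def basic_set_def)
  have atlas: "smooth_atlas A"
    using assms(1) by (simp add: riemannian_manifold_def)
  have nbhd: "\<Lambda> \<subseteq> interior U"
    using assms(4) by (simp add: neighbourhood_of_def)
  have pre: "f -` \<Lambda> \<inter> U = \<Lambda>"
    using preimage_of_maximal_invariant_set[OF assms(5) inv] assms(6) closure_subset[of U] by blast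
  have loc: "\<exists>V. open V \<and> y \<in> V \<and> inj_on f V \<and> (\<forall>W. open W \<and> W \<subseteq> V \<longrightarrow> open (f ` W))"
    if "y \<in> \<Lambda>" for y
  proof -
    have "y \<notin> critical_set A f"
      using noncrit that by blast
    then show ?thesis
      using noncritical_locally_injective_open[OF atlas assms(2)] by metis
  qed
  have cont: "continuous_on \<Lambda> f"
    using assms(2) unfolding Ck_map_def by (meson continuous_on_subset subset_UNIV)
  have inj: "\<exists>N. openin (top_of_set \<Lambda>) N \<and> y \<in> N \<and> inj_on f N" if "y \<in> \<Lambda>" for y
    using loc[OF that] that by (metis Int_iff inf_le2 inj_on_subset openin_open_Int)
  have openmap: "openin (top_of_set \<Lambda>) (f ` W)" if "openin (top_of_set \<Lambda>) W" for W
  proof (rule open_map_restrict[OF _ nbhd _ _ that])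
    show "\<exists>V. open V \<and> y \<in> V \<and> (\<forall>W. open W \<and> W \<subseteq> V \<longrightarrow> open (f ` W))" if "y \<in> \<Lambda>" for y
      using loc[OF that] by metis
  qed (simp_all add: inv pre)
  note fibres = local_homeomorphism_compact_fibres[OF cpt cont _ inj openmap]
  have "\<exists>N. \<forall>x\<in>\<Lambda>. card (f -` {x} \<inter> \<Lambda>) = N" if "connected \<Lambda>"
    using locally_constant_imp_constant[OF that fibres(2)] by (simp add: constant_on_def)
  then show ?thesis
    using pre fibres(1) by blast
qed

end
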